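(* Let $m\ge1$, let $\omega=(w_1,\ldots,w_m)$ be a probability vector, and let $A_i=\begin{bmatrix}\widetilde a_{11}^{(i)} & \widetilde a_{12}^{(i)}\\ 0 & \widetilde a_{22}^{(i)}\end{bmatrix}\in\mathrm{UT}_2$ for $i=1,\ldots,m$. Let $D=\operatorname{diag}(d_1,d_2)=\operatorname{diag}(A_1^{w_1}\cdots A_m^{w_m})$. Then the log-Euclidean mean $LE(\omega;A_1,\ldots,A_m)=\exp\left(\sum_{i=1}^m w_i\log(A_i)\right)$ is given by $$LE(\omega;A_1,\ldots,A_m)=D+\frac{\sum_{i=1}^m w_i\, f\bigl(\widetilde a_{11}^{(i)},\widetilde a_{22}^{(i)}\bigr)\,\widetilde a_{12}^{(i)}}{f(d_1,d_2)}\,E_{12}.$$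
   Context: $\mathrm{UT}_2$ is the group of $2\times 2$ real upper triangular matrices with positive diagonal entries. A probability vector has nonnegative entries summing to $1$. For $A\in\mathrm{UT}_2$, $\log A$ is the principal logarithm (the unique real upper triangular matrix $L$ with $\exp L=A$), and $A^{p}=\exp(p\log A)$ for $p\in\mathbb{R}$. $\operatorname{diag}(A)$ is the diagonal matrix formed from the diagonal entries of $A$, and $\operatorname{diag}(d_1,d_2)$ is the diagonal matrix with the given entries. For $x,y>0$, $f(x,y)=\dfrac{\log x-\log y}{x-y}$ if $x\neq y$, and $f(x,x)=1/x$. $E_{12}$ is the $2\times2$ matrix with $1$ in the $(1,2)$-entry and $0$ elsewhere. *)

theory Defs
  imports "HOL-Analysis.Analysis"
begin

text \<open>
  Matrices have type \<open>real^2^2\<close>. The library's \<open>*\<close> on this type is entrywise, so powers,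
  exponentials and products of matrices are built here from the matrix product \<open>**\<close>.
\<close>

primrec mat_pow :: "real^'n^'n \<Rightarrow> nat \<Rightarrow> real^'n^'n" where
  "mat_pow A 0 = mat 1"
| "mat_pow A (Suc k) = A ** mat_pow A k"

definition mat_exp :: "real^'n^'n \<Rightarrow> real^'n^'n" where
  "mat_exp A = (\<Sum>k. (1 / fact k) *\<^sub>R mat_pow A k)"

definition upper_tri :: "real^2^2 \<Rightarrow> bool" where
  "upper_tri A \<longleftrightarrow> A $ 2 $ 1 = 0"

definition UT2 :: "(real^2^2) set" where
  "UT2 = {A. upper_tri A \<and> 0 < A $ 1 $ 1 \<and> 0 < A $ 2 $ 2}"

text \<open>Only meaningful on \<^const>\<open>UT2\<close>, where the logarithm exists and is unique.\<close>

definition mat_log :: "real^2^2 \<Rightarrow> real^2^2" where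
  "mat_log A = (THE L. upper_tri L \<and> mat_exp L = A)"

definition mat_rpow :: "real^2^2 \<Rightarrow> real \<Rightarrow> real^2^2" where
  "mat_rpow A p = mat_exp (p *\<^sub>R mat_log A)"

definition mat_prod_list :: "(real^'n^'n) list \<Rightarrow> real^'n^'n" where
  "mat_prod_list As = foldr (**) As (mat 1)"

definition diag_part :: "real^'n^'n \<Rightarrow> real^'n^'n" where
  "diag_part A = (\<chi> i j. if i = j then A $ i $ j else 0)"

definition mat2 :: "real \<Rightarrow> real \<Rightarrow> real \<Rightarrow> real \<Rightarrow> real^2^2" where
  "mat2 a b c d = vector [vector [a, b], vector [c, d]]"

definition diag2 :: "real \<Rightarrow> real \<Rightarrow> real^2^2" where
  "diag2 d1 d2 = mat2 d1 0 0 d2"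

definition E12 :: "real^2^2" where
  "E12 = mat2 0 1 0 0"

text \<open>The divided difference of \<open>ln\<close>, used only for positive arguments.\<close>

definition ln_dd :: "real \<Rightarrow> real \<Rightarrow> real" where
  "ln_dd x y = (if x = y then 1 / x else (ln x - ln y) / (x - y))"

definition prob_vector :: "nat \<Rightarrow> (nat \<Rightarrow> real) \<Rightarrow> bool" where
  "prob_vector m w \<longleftrightarrow> (\<forall>i\<in>{1..m}. 0 \<le> w i) \<and> (\<Sum>i=1..m. w i) = 1"

text \<open>Families indexed by \<open>1, \<dots>, m\<close> are functions on \<open>nat\<close> whose other values are ignored.\<close>

definition LE_mean :: "nat \<Rightarrow> (nat \<Rightarrow> real) \<Rightarrow> (nat \<Rightarrow> real^2^2) \<Rightarrow> real^2^2" where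
  "LE_mean m w A = mat_exp (\<Sum>i=1..m. w i *\<^sub>R mat_log (A i))"

end

theory Submission
  imports Defs
begin

text \<open>
  On upper triangular matrices the exponential sends the off-diagonal entry \<open>q\<close> to
  \<open>q * (exp p - exp r) / (p - r)\<close>, which is \<open>q / ln_dd (exp p) (exp r)\<close>. Consequently the logarithm
  multiplies the off-diagonal entry by \<^const>\<open>ln_dd\<close> of the diagonal, so the formula is read off
  once \<open>ln d\<^sub>1\<close> and \<open>ln d\<^sub>2\<close> are recognised as the diagonal entries of the weighted sum of logarithms.
\<close>

lemma mat2_nth [simp]:
  "mat2 a b c d $ 1 $ 1 = a" "mat2 a b c d $ 1 $ 2 = b"
  "mat2 a b c d $ 2 $ 1 = c" "mat2 a b c d $ 2 $ 2 = d"
  by (simp_all add: mat2_def)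

lemma mat2_eqI:
  fixes X Y :: "real^2^2"
  assumes "X $ 1 $ 1 = Y $ 1 $ 1" "X $ 1 $ 2 = Y $ 1 $ 2"
    "X $ 2 $ 1 = Y $ 2 $ 1" "X $ 2 $ 2 = Y $ 2 $ 2"
  shows "X = Y"
  using assms by (simp add: vec_eq_iff forall_2)

lemma mat2_eq_iff: "mat2 a b c d = mat2 a' b' c' d' \<longleftrightarrow> a = a' \<and> b = b' \<and> c = c' \<and> d = d'"
  by (metis mat2_nth)

lemma upper_triE:
  assumes "upper_tri L"
  obtains p q r where "L = mat2 p q 0 r"
proof
  show "L = mat2 (L $ 1 $ 1) (L $ 1 $ 2) 0 (L $ 2 $ 2)"
    using assms by (intro mat2_eqI) (simp_all add: upper_tri_def)
qed

lemma mat2_mult: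
  "mat2 a b c d ** mat2 a' b' c' d' = mat2 (a*a' + b*c') (a*b' + b*d') (c*a' + d*c') (c*b' + d*d')"
  by (rule mat2_eqI) (simp_all add: matrix_matrix_mult_def sum_2)

lemma scaleR_mat2: "k *\<^sub>R mat2 a b c d = mat2 (k*a) (k*b) (k*c) (k*d)"
  by (rule mat2_eqI) simp_all

lemma sum_mat2:
  "(\<Sum>i\<in>I. mat2 (a i) (b i) (c i) (d i)) = mat2 (sum a I) (sum b I) (sum c I) (sum d I)"
  by (rule mat2_eqI) simp_all

lemma sums_mat2:
  assumes "a sums a'" "b sums b'" "c sums c'" "d sums d'"
  shows "(\<lambda>k. mat2 (a k) (b k) (c k) (d k)) sums mat2 a' b' c' d'"
  unfolding sums_def
proof (intro vec_tendstoI)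
  fix i j :: 2
  show "(\<lambda>n. (\<Sum>k<n. mat2 (a k) (b k) (c k) (d k)) $ i $ j) \<longlonglongrightarrow> mat2 a' b' c' d' $ i $ j"
    using assms exhaust_2[of i] exhaust_2[of j] by (auto simp: sums_def)
qed

text \<open>The sum is the divided difference of \<open>x ^ k\<close> at \<open>p\<close> and
  \<open>r\<close>. Written as a polynomial instead of a quotient, it also covers
  \<open>p = r\<close>.\<close>

lemma mat_pow_upper_tri:
  "mat_pow (mat2 p q 0 r) k = mat2 (p ^ k) (q * (\<Sum>i<k. p ^ i * r ^ (k - Suc i))) 0 (r ^ k)"
proof (induction k)
  case 0
  show ?case by (rule mat2_eqI) (simp_all add: mat_def)
next
  case (Suc k)
  have "(\<Sum>i<Suc k. p ^ i * r ^ (Suc k - Suc i)) = r ^ k + p * (\<Sum>i<k. p ^ i * r ^ (k - Suc i))"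
    by (simp add: sum.lessThan_Suc_shift sum_distrib_left mult.assoc del: sum.lessThan_Suc)
  then show ?case
    by (simp add: Suc mat2_mult mat2_eq_iff algebra_simps del: sum.lessThan_Suc)
qed

lemma sums_exp_real: "(\<lambda>k. 1 / fact k * x ^ k) sums exp (x::real)"
  using exp_converges[of x] by (simp add: field_simps)

text \<open>Summing the divided differences of \<open>x ^ k / fact k\<close> gives that of
  \<open>exp\<close> at \<open>p\<close> and \<open>r\<close>. Since \<open>ln\<close> inverts
  \<open>exp\<close>, this is the reciprocal of the divided difference of \<open>ln\<close> at
  \<open>exp p\<close> and \<open>exp r\<close>.\<close>

lemma exp_divided_difference_sums:
  "(\<lambda>k. 1 / fact k * (\<Sum>i<k. p ^ i * r ^ (k - Suc i))) sums inverse (ln_dd (exp p) (exp r))"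
proof (cases "p = r")
  case True
  \<comment> \<open>The term at \<open>k = 0\<close> is an empty sum, so the series may start at
    \<open>Suc k\<close>. There \<open>Suc k\<close> equal summands cancel one factor of the
    factorial, leaving the series of \<open>exp p\<close>.\<close>
  have "(\<lambda>k. 1 / fact (Suc k) * (\<Sum>i<Suc k. p ^ i * r ^ (Suc k - Suc i))) = (\<lambda>k. 1 / fact k * p ^ k)"
  proof
    fix k
    have "(\<Sum>i<Suc k. p ^ i * r ^ (Suc k - Suc i)) = (\<Sum>i<Suc k. p ^ k)"
      using True by (intro sum.cong) (auto simp flip: power_add)
    then show "1 / fact (Suc k) * (\<Sum>i<Suc k. p ^ i * r ^ (Suc k - Suc i)) = 1 / fact k * p ^ k"
      by (simp add: field_simps del: sum.lessThan_Suc of_nat_Suc)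
  qed
  then show ?thesis
    using True sums_exp_real[of p] sums_Suc_iff[of "\<lambda>k. 1 / fact k * (\<Sum>i<k. p ^ i * r ^ (k - Suc i))"]
    by (simp add: ln_dd_def)
next
  case False
  have "(\<lambda>k. (1 / fact k * p ^ k - 1 / fact k * r ^ k) / (p - r)) sums ((exp p - exp r) / (p - r))"
    by (intro sums_divide sums_diff sums_exp_real)
  moreover have "(1 / fact k * p ^ k - 1 / fact k * r ^ k) / (p - r)
      = 1 / fact k * (\<Sum>i<k. p ^ i * r ^ (k - Suc i))" for k
  proof -
    have "(p ^ k - r ^ k) / (p - r) = (\<Sum>i<k. p ^ i * r ^ (k - Suc i))"
      using False by (simp add: power_diff_sumr2 mult.commute)
    then show ?thesis
      by (metis right_diff_distrib times_divide_eq_right)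
  qed
  ultimately show ?thesis
    using False by (simp add: ln_dd_def inverse_eq_divide)
qed

lemma mat_exp_upper_tri:
  "mat_exp (mat2 p q 0 r) = mat2 (exp p) (q / ln_dd (exp p) (exp r)) 0 (exp r)"
proof -
  have "(\<lambda>k. (1 / fact k) *\<^sub>R mat_pow (mat2 p q 0 r) k)
      sums mat2 (exp p) (q * inverse (ln_dd (exp p) (exp r))) 0 (exp r)"
    unfolding mat_pow_upper_tri scaleR_mat2 mult.left_commute[of _ q] mult_zero_right
    by (intro sums_mat2 sums_exp_real sums_mult exp_divided_difference_sums sums_zero)
  then show ?thesis
    unfolding mat_exp_def divide_inverse by (rule sums_unique [symmetric])
qed

text \<open>For distinct arguments this is injectivity of \<open>ln\<close> on the positive
  reals.\<close>

lemma ln_dd_nonzero: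
  assumes "0 < x" "0 < y"
  shows "ln_dd x y \<noteq> 0"
  using assms by (simp add: ln_dd_def)

text \<open>Uniqueness: the diagonal of \<open>mat_exp L\<close> determines \<open>p\<close> and
  \<open>r\<close>, as \<open>exp\<close> is injective. The remaining equation is linear in
  \<open>q\<close> with nonzero coefficient.\<close>

lemma mat_log_upper_tri:
  assumes "0 < a" "0 < c"
  shows "mat_log (mat2 a b 0 c) = mat2 (ln a) (ln_dd a c * b) 0 (ln c)"
  unfolding mat_log_def
proof (rule the_equality)
  show "upper_tri (mat2 (ln a) (ln_dd a c * b) 0 (ln c)) \<and>
      mat_exp (mat2 (ln a) (ln_dd a c * b) 0 (ln c)) = mat2 a b 0 c"
    using assms ln_dd_nonzero[OF assms] by (simp add: upper_tri_def mat_exp_upper_tri)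
next
  fix L
  assume L: "upper_tri L \<and> mat_exp L = mat2 a b 0 c"
  then obtain p q r where "L = mat2 p q 0 r" by (blast elim: upper_triE)
  with L show "L = mat2 (ln a) (ln_dd a c * b) 0 (ln c)"
    using ln_dd_nonzero[OF assms] by (auto simp: mat_exp_upper_tri mat2_eq_iff)
qed

text \<open>Diagonal entries multiply independently of the upper right ones. Only the diagonal
  enters \<open>D\<close>, so the upper right entry stays an anonymous \<open>x\<close>.\<close>

lemma mat_prod_list_upper_tri:
  "\<exists>x. mat_prod_list (map (\<lambda>i. mat2 (p i) (q i) 0 (r i)) is)
    = mat2 (prod_list (map p is)) x 0 (prod_list (map r is))"
proof (induction "is")
  case Nil
  have "mat 1 = mat2 1 0 0 1"
    by (rule mat2_eqI) (simp_all add: mat_def)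
  then show ?case by (auto simp: mat_prod_list_def)
next
  case (Cons i "is")
  then show ?case by (auto simp: mat_prod_list_def mat2_mult mat2_eq_iff)
qed

theorem theorem3p2:
  fixes m :: nat
    and w :: "nat \<Rightarrow> real"
    and A :: "nat \<Rightarrow> real^2^2"
    and a11 a12 a22 :: "nat \<Rightarrow> real"
    and D :: "real^2^2"
    and d1 d2 :: real
  assumes "1 \<le> m"
    and "prob_vector m w"
    and "\<And>i. i \<in> {1..m} \<Longrightarrow> A i \<in> UT2"
    and "\<And>i. i \<in> {1..m} \<Longrightarrow> A i = mat2 (a11 i) (a12 i) 0 (a22 i)"
    and "D = diag_part (mat_prod_list (map (\<lambda>i. mat_rpow (A i) (w i)) [1..<Suc m]))"
    and "D = diag2 d1 d2"
  shows "LE_mean m w A =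
    D + ((\<Sum>i=1..m. w i * ln_dd (a11 i) (a22 i) * a12 i) / ln_dd d1 d2) *\<^sub>R E12"
proof -
  let ?S = "\<lambda>a. \<Sum>i=1..m. w i * ln (a i)"
  let ?q = "\<Sum>i=1..m. w i * ln_dd (a11 i) (a22 i) * a12 i"
  have log: "mat_log (A i) = mat2 (ln (a11 i)) (ln_dd (a11 i) (a22 i) * a12 i) 0 (ln (a22 i))"
    if "i \<in> {1..m}" for i
    using assms(3)[OF that] assms(4)[OF that] by (simp add: UT2_def mat_log_upper_tri)
  \<comment> \<open>The upper right entries of the powers do not affect the diagonal of their
    product, so they are hidden behind \<open>q\<close>.\<close>
  obtain q where powers: "map (\<lambda>i. mat_rpow (A i) (w i)) [1..<Suc m] =
      map (\<lambda>i. mat2 (exp (w i * ln (a11 i))) (q i) 0 (exp (w i * ln (a22 i)))) [1..<Suc m]"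
  proof
    show "map (\<lambda>i. mat_rpow (A i) (w i)) [1..<Suc m] =
      map (\<lambda>i. mat2 (exp (w i * ln (a11 i)))
        (w i * (ln_dd (a11 i) (a22 i) * a12 i) / ln_dd (exp (w i * ln (a11 i))) (exp (w i * ln (a22 i))))
        0 (exp (w i * ln (a22 i)))) [1..<Suc m]"
      by (intro map_cong refl) (auto simp: mat_rpow_def log scaleR_mat2 mat_exp_upper_tri simp del: upt_Suc)
  qed
  have prods: "prod_list (map (\<lambda>i. exp (w i * ln (a i))) [1..<Suc m]) = exp (?S a)" for a
    by (simp add: exp_sum prod.distinct_set_conv_list [symmetric] atLeastLessThanSuc_atLeastAtMost
        del: upt_Suc)
  obtain x where
    "mat_prod_list (map (\<lambda>i. mat_rpow (A i) (w i)) [1..<Suc m]) = mat2 (exp (?S a11)) x 0 (exp (?S a22))"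
    using mat_prod_list_upper_tri[of "\<lambda>i. exp (w i * ln (a11 i))" q "\<lambda>i. exp (w i * ln (a22 i))" "[1..<Suc m]"]
    unfolding powers prods by blast
  then have "diag2 d1 d2 $ 1 $ 1 = exp (?S a11)" "diag2 d1 d2 $ 2 $ 2 = exp (?S a22)"
    using assms(5,6) by (simp_all add: diag_part_def)
  then have d: "d1 = exp (?S a11)" "d2 = exp (?S a22)"
    by (simp_all add: diag2_def)
  \<comment> \<open>The weighted sum of logarithms has diagonal \<open>ln d1\<close>,
    \<open>ln d2\<close>, so its exponential divides \<open>?q\<close> by
    \<open>ln_dd d1 d2\<close>.\<close>
  have "LE_mean m w A = mat_exp (mat2 (?S a11) ?q 0 (?S a22))"
    by (simp add: LE_mean_def log scaleR_mat2 sum_mat2 mult.assoc)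
  also have "\<dots> = mat2 d1 (?q / ln_dd d1 d2) 0 d2"
    by (simp add: mat_exp_upper_tri d)
  also have "\<dots> = D + (?q / ln_dd d1 d2) *\<^sub>R E12"
    unfolding assms(6) by (rule mat2_eqI) (simp_all add: diag2_def E12_def)
  finally show ?thesis .
qed

end
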